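(* Let $\Omega$ be a locally compact Hausdorff space with countable base, $G(x,dy)$ a Radon kernel in $\Omega$, and $h:\Omega\to(0,+\infty)$ a lower semicontinuous function. Assume that $G$ satisfies the weak domination principle in $\Omega$ with respect to $h$, with constant $\mathfrak{b}\ge1$. Let $q\in\mathbb{R}\setminus\{0\}$. Suppose that: if $q>0$, $u:\Omega\to[0,+\infty)$ is a measurable function satisfying $$u(x)\ge G(u^q)(x)+h(x)\quad\text{in }\Omega;$$ if $q<0$, $u:\Omega\to(0,+\infty)$ is a measurable function satisfying $$u(x)\le -G(u^q)(x)+h(x)\quad\text{in }\Omega .$$ Then $u$ satisfies the following estimates for all $x\in\Omega$: (i) If $q>0$, $q\ne1$, then $$u(x)\ge h(x)\left\{1+\mathfrak{b}\left[\left(1+\frac{(1-q)\,G(h^q)(x)}{\mathfrak{b}\,h(x)}\right)^{\frac1{1-q}}-1\right]\right\},$$ where in the case $q>1$ necessarily $$G(h^q)(x)<\frac{\mathfrak{b}}{q-1}\,h(x).$$ (ii) If $q=1$, then $$u(x)\ge h(x)\left[1+\mathfrak{b}\Big(e^{\mathfrak{b}^{-1}\frac{G(h)(x)}{h(x)}}-1\Big)\right].$$ (iii) If $q<0$, then $$u(x)\le h(x)\left\{1-\mathfrak{b}\left[1-\Big(1-\frac{(1-q)\,G(h^q)(x)}{\mathfrak{b}\,h(x)}\Big)^{\frac1{1-q}}\right]\right\}$$ and necessarily $$G(h^q)(x)<\frac{\mathfrak{b}}{1-q}\Big[1-(1-\mathfrak{b}^{-1})^{1-q}\Big]h(x).$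$
   Context: A Radon kernel $G(x,dy)$ in $\Omega$: for each $x\in\Omega$, $G(x,dy)$ is a Radon measure on $\Omega$, and for every (Borel) measurable $f:\Omega\to[0,\infty]$ the function $Gf(x)=\int_\Omega f(y)\,G(x,dy)$ is measurable. Weak domination principle with respect to $h$ with constant $\mathfrak{b}\ge1$: for any non-negative bounded measurable function $f$ with compact support, if $Gf(x)\le h(x)$ for all $x\in\mathrm{supp}(f)$, then $Gf(x)\le\mathfrak{b}\,h(x)$ for all $x\in\Omega$. *)

theory Defs
  imports "HOL-Analysis.Analysis"
begin

(* Inner regularity is required on all Borel sets. In a locally compact Hausdorff space with
   countable base this agrees with the other usual definitions of a Radon measure, and every
   Borel measure that is finite on compact sets satisfies it. *)
definition radon_measure :: "'a::t2_space measure \<Rightarrow> bool" where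
  "radon_measure M \<longleftrightarrow>
     sets M = sets borel \<and>
     (\<forall>K. compact K \<longrightarrow> emeasure M K < \<infinity>) \<and>
     (\<forall>A\<in>sets borel. emeasure M A = (SUP K\<in>{K. compact K \<and> K \<subseteq> A}. emeasure M K))"

definition kernel_op :: "('a \<Rightarrow> 'a measure) \<Rightarrow> ('a \<Rightarrow> ennreal) \<Rightarrow> 'a \<Rightarrow> ennreal" where
  "kernel_op G f x = (\<integral>\<^sup>+ y. f y \<partial>(G x))"

definition radon_kernel :: "('a::t2_space \<Rightarrow> 'a measure) \<Rightarrow> bool" where
  "radon_kernel G \<longleftrightarrow>
     (\<forall>x. radon_measure (G x)) \<and>
     (\<forall>f\<in>borel_measurable borel. kernel_op G f \<in> borel_measurable borel)"

definition closed_support :: "('a::topological_space \<Rightarrow> real) \<Rightarrow> 'a set" where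
  "closed_support f = closure {x. f x \<noteq> 0}"

definition lower_semicontinuous :: "('a::topological_space \<Rightarrow> real) \<Rightarrow> bool" where
  "lower_semicontinuous h \<longleftrightarrow> (\<forall>c. open {x. c < h x})"

definition weak_domination_principle ::
  "('a::t2_space \<Rightarrow> 'a measure) \<Rightarrow> ('a \<Rightarrow> real) \<Rightarrow> real \<Rightarrow> bool" where
  "weak_domination_principle G h b \<longleftrightarrow>
     (\<forall>f :: 'a \<Rightarrow> real.
        f \<in> borel_measurable borel \<longrightarrow> (\<forall>x. 0 \<le> f x) \<longrightarrow> bounded (range f) \<longrightarrow>
        compact (closed_support f) \<longrightarrow>
        (\<forall>x\<in>closed_support f. kernel_op G (\<lambda>y. ennreal (f y)) x \<le> ennreal (h x)) \<longrightarrow>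
        (\<forall>x. kernel_op G (\<lambda>y. ennreal (f y)) x \<le> ennreal (b * h x)))"

(* G(v^q)(x) for a real-valued v with values in [0,\<infinity>) if q > 0, in (0,\<infinity>) if q < 0; on these
   ranges powr is the usual power (with 0 powr q = 0). The value may be \<infinity>. *)
definition kernel_pow :: "('a \<Rightarrow> 'a measure) \<Rightarrow> real \<Rightarrow> ('a \<Rightarrow> real) \<Rightarrow> 'a \<Rightarrow> ennreal" where
  "kernel_pow G q v = kernel_op G (\<lambda>y. ennreal (v y powr q))"

end

theory Submission
  imports Defs
begin

text \<open>Put \<open>f = u\<^sup>q\<close> and \<open>w = Gf / h\<close>, so that \<open>u \<ge> h (1 + w)\<close> if \<open>q > 0\<close> and \<open>u \<le> h (1 - w)\<close> if
  \<open>q < 0\<close>. In both cases \<open>h\<^sup>q \<le> f \<phi>(w)\<close> with the decreasing function \<open>\<phi>(s) = (1 \<plusminus> s)\<^sup>-\<^sup>q\<close>.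
  By weak domination, \<open>G(f 1\<^sub>A)(x) \<le> min {b s h(x), w(x) h(x)}\<close> for \<open>A = {w \<le> s}\<close>, and the layer cake
  formula turns this into \<open>G(f \<phi>(w))(x) \<le> b h(x) \<integral>\<^sub>0 \<phi>\<close> with upper limit \<open>w(x) / b\<close>. Evaluating
  this integral bounds \<open>G(h\<^sup>q)(x)\<close> in terms of \<open>w(x)\<close>; solving for \<open>w(x)\<close> gives the estimates of \<open>u(x)\<close>,
  and the range of the integral gives the necessary conditions on \<open>G(h\<^sup>q)(x)\<close>.\<close>

section \<open>Weak domination, from compact to measurable sets\<close>

lemma borel_measurable_lower_semicontinuous:
  assumes "lower_semicontinuous h"
  shows "h \<in> borel_measurable borel"
  using assms unfolding lower_semicontinuous_def
  by (auto simp: borel_measurable_iff_greater intro!: borel_open)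

text \<open>The principle speaks only of bounded functions with compact support, so \<open>f\<close>
  is truncated at height \<open>n\<close> and restricted to \<open>K\<close>. Dividing by
  \<open>s\<close> turns the bound by \<open>s * h\<close> on \<open>K\<close> into the bound by
  \<open>h\<close> that the principle asks for; the factor is restored at the end.\<close>

lemma weak_domination_compact:
  assumes wdp: "weak_domination_principle G h b"
    and f: "f \<in> borel_measurable borel" "\<And>y. 0 \<le> f y" and h: "\<And>y. 0 < h y"
    and s: "0 < s" and K: "compact K"
    and le: "\<And>y. y \<in> K \<Longrightarrow> kernel_op G (\<lambda>z. ennreal (f z)) y \<le> ennreal (s * h y)"
    and G: "\<And>y. sets (G y) = sets borel"
  shows "kernel_op G (\<lambda>y. ennreal (min (f y) (real n) * indicator K y)) x \<le> ennreal (s * (b * h x))"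
proof -
  define g where "g y = min (f y) (real n) * indicator K y / s" for y
  note [measurable] = f(1) borel_compact[OF K]
  have [measurable_cong]: "sets (G y) = sets borel" for y by (rule G)
  have g [measurable]: "g \<in> borel_measurable borel"
    unfolding g_def by measurable
  have sg: "(\<lambda>y. ennreal (min (f y) (real n) * indicator K y)) = (\<lambda>y. ennreal s * ennreal (g y))"
    using s by (auto simp: g_def fun_eq_iff ennreal_mult'[symmetric])
  have scale: "kernel_op G (\<lambda>y. ennreal (min (f y) (real n) * indicator K y)) y
      = ennreal s * kernel_op G (\<lambda>y. ennreal (g y)) y" for y
    unfolding sg kernel_op_def by (rule nn_integral_cmult) measurable
  \<comment> \<open>Compact sets are closed here, so passing to the closure of
    \<open>{y. g y \<noteq> 0}\<close> does not leave \<open>K\<close>, where the potential is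
    controlled.\<close>
  have supp: "closed_support g \<subseteq> K"
    unfolding closed_support_def
    by (rule closure_minimal) (auto simp: g_def indicator_def compact_imp_closed K)
  have "compact (closed_support g)"
    using compact_Int_closed[OF K, of "closed_support g"] supp
    by (simp add: closed_support_def inf_absorb2)
  moreover have "bounded (range g)"
    by (rule boundedI[of _ "real n / s"])
       (use s f(2) in \<open>auto simp: g_def indicator_def divide_simps\<close>)
  moreover have "0 \<le> g y" for y
    using s f(2) by (simp add: g_def)
  moreover have "kernel_op G (\<lambda>z. ennreal (g z)) y \<le> ennreal (h y)" if "y \<in> closed_support g" for y
  proof -
    have "ennreal s * kernel_op G (\<lambda>z. ennreal (g z)) y \<le> kernel_op G (\<lambda>z. ennreal (f z)) y"
      unfolding scale[symmetric] unfolding kernel_op_def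
      by (intro nn_integral_mono ennreal_leI) (use f(2) in \<open>auto simp: indicator_def\<close>)
    also have "\<dots> \<le> ennreal s * ennreal (h y)"
      using le that supp s h[of y] by (auto simp: ennreal_mult'[symmetric])
    finally show ?thesis
      using s by (simp add: ennreal_mult_le_mult_iff)
  qed
  ultimately have "kernel_op G (\<lambda>y. ennreal (g y)) x \<le> ennreal (b * h x)"
    using wdp g unfolding weak_domination_principle_def by blast
  then show ?thesis
    unfolding scale using s by (simp add: ennreal_mult' mult_left_mono)
qed

text \<open>Inner regularity is used only on the sets where \<open>f\<close> exceeds a positive constant; these have
  finite measure because \<open>Gf(x)\<close> is finite.\<close>

lemma weak_domination_measurable:
  assumes G: "radon_kernel G" and wdp: "weak_domination_principle G h b"
    and f: "f \<in> borel_measurable borel" "\<And>y. 0 \<le> f y" and h: "\<And>y. 0 < h y"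
    and s: "0 < s" and A: "A \<in> sets borel"
    and le: "\<And>y. y \<in> A \<Longrightarrow> kernel_op G (\<lambda>z. ennreal (f z)) y \<le> ennreal (s * h y)"
    and fin: "kernel_op G (\<lambda>y. ennreal (f y)) x < \<infinity>"
  shows "kernel_op G (\<lambda>y. ennreal (f y) * indicator A y) x \<le> ennreal (s * (b * h x))"
proof -
  note [measurable] = f(1) A
  have rad: "radon_measure (G y)" for y
    using G by (simp add: radon_kernel_def)
  have sets_G [measurable_cong]: "sets (G y) = sets borel" for y
    using rad by (simp add: radon_measure_def)
  define B where "B n = A \<inter> {y. 1 / real (Suc n) < f y}" for n
  have B [measurable]: "B n \<in> sets borel" for n
    unfolding B_def by measurable
  have "(\<integral>\<^sup>+ y. ennreal (min (f y) (real n) * indicator (B n) y) \<partial>G x) \<le> ennreal (s * (b * h x))" for n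
  proof (rule ennreal_le_epsilon)
    fix e :: real assume e: "0 < e"
    \<comment> \<open>The compact \<open>K\<close> chosen below misses at most mass \<open>d\<close>
      of \<open>B n\<close>. The integrand is at most \<open>n\<close>, so the missed part costs at
      most \<open>n * d \<le> e\<close>.\<close>
    define d where "d = e / real (Suc n)"
    have d: "0 < d" "real n * d \<le> e"
      using e by (auto simp: d_def field_simps)
    \<comment> \<open>Markov's inequality: \<open>B n\<close> has finite mass, so inner regularity
      gives approximation up to an additive error.\<close>
    have "emeasure (G x) (B n) \<le> emeasure (G x) {y \<in> space (G x). 1 \<le> ennreal (real (Suc n)) * ennreal (f y)}"
      using sets_eq_imp_space_eq[OF sets_G] f(2)
      by (intro emeasure_mono)
         (auto simp: B_def ennreal_mult'[symmetric] field_simps ennreal_leI simp flip: ennreal_1 simp del: of_nat_Suc)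
    also have "\<dots> \<le> ennreal (real (Suc n)) * (\<integral>\<^sup>+ y. ennreal (f y) * indicator (space (G x)) y \<partial>G x)"
      using nn_integral_Markov_inequality[of "\<lambda>y. ennreal (f y)" "space (G x)" "G x" "ennreal (real (Suc n))"]
      by simp
    also have "(\<integral>\<^sup>+ y. ennreal (f y) * indicator (space (G x)) y \<partial>G x) = kernel_op G (\<lambda>y. ennreal (f y)) x"
      unfolding kernel_op_def by (intro nn_integral_cong) simp
    finally have finB: "emeasure (G x) (B n) < \<infinity>"
      using fin by (auto simp: ennreal_mult_less_top intro: le_less_trans)
    have reg: "emeasure (G x) (B n) = (SUP K\<in>{K. compact K \<and> K \<subseteq> B n}. emeasure (G x) K)"
      using rad[of x] B by (simp add: radon_measure_def)
    have "{K. compact K \<and> K \<subseteq> B n} \<noteq> {}"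
      using compact_empty by blast
    from SUP_approx_ennreal[OF d(1) this reg less_imp_neq[OF finB]]
    obtain K where K: "compact K" "K \<subseteq> B n"
        and KB: "emeasure (G x) (B n) < emeasure (G x) K + ennreal d"
      by blast
    note [measurable] = borel_compact[OF K(1)]
    have "emeasure (G x) (B n) = emeasure (G x) K + emeasure (G x) (B n - K)"
      using K(2) by (subst plus_emeasure) (auto simp: Un_absorb1 sets_G)
    moreover have "emeasure (G x) K < \<infinity>"
      using K(2) by (intro le_less_trans[OF emeasure_mono finB]) (auto simp: sets_G)
    ultimately have BK: "emeasure (G x) (B n - K) \<le> ennreal d"
      using KB by (metis ennreal_add_left_cancel_less infinity_ennreal_def less_imp_le)
    have "(\<integral>\<^sup>+ y. ennreal (min (f y) (real n) * indicator (B n) y) \<partial>G x)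
        \<le> (\<integral>\<^sup>+ y. ennreal (min (f y) (real n) * indicator K y) + ennreal (real n) * indicator (B n - K) y \<partial>G x)"
      by (intro nn_integral_mono) (auto simp: indicator_def intro: ennreal_leI)
    also have "\<dots> = (\<integral>\<^sup>+ y. ennreal (min (f y) (real n) * indicator K y) \<partial>G x)
        + ennreal (real n) * emeasure (G x) (B n - K)"
      by (subst nn_integral_add) (auto simp: nn_integral_cmult_indicator sets_G)
    also have "\<dots> \<le> ennreal (s * (b * h x)) + ennreal e"
    proof (rule add_mono)
      show "(\<integral>\<^sup>+ y. ennreal (min (f y) (real n) * indicator K y) \<partial>G x) \<le> ennreal (s * (b * h x))"
        using weak_domination_compact[OF wdp f h s K(1) _ sets_G, of n x] le K(2)
        unfolding kernel_op_def[of G _ x] B_def by blast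
      have "ennreal (real n) * emeasure (G x) (B n - K) \<le> ennreal (real n) * ennreal d"
        by (rule mult_left_mono[OF BK]) simp
      also have "\<dots> \<le> ennreal e"
        using d by (simp add: ennreal_mult'[symmetric] ennreal_leI)
      finally show "ennreal (real n) * emeasure (G x) (B n - K) \<le> ennreal e" .
    qed
    finally show "(\<integral>\<^sup>+ y. ennreal (min (f y) (real n) * indicator (B n) y) \<partial>G x)
        \<le> ennreal (s * (b * h x)) + ennreal e" .
  qed
  \<comment> \<open>Fatou's lemma removes the truncations. Where \<open>f\<close> is positive on
    \<open>A\<close>, both \<open>1 / (n + 1) < f y\<close> and \<open>f y \<le> n\<close> hold for
    large \<open>n\<close>; elsewhere the limit integrand vanishes.\<close>
  then have "liminf (\<lambda>n. \<integral>\<^sup>+ y. ennreal (min (f y) (real n) * indicator (B n) y) \<partial>G x)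
      \<le> ennreal (s * (b * h x))"
    by (intro order_trans[OF Liminf_le_Limsup Limsup_bounded]) auto
  moreover have "kernel_op G (\<lambda>y. ennreal (f y) * indicator A y) x
      \<le> (\<integral>\<^sup>+ y. liminf (\<lambda>n. ennreal (min (f y) (real n) * indicator (B n) y)) \<partial>G x)"
    unfolding kernel_op_def
  proof (intro nn_integral_mono Liminf_bounded)
    fix y
    show "\<forall>\<^sub>F n in sequentially.
        ennreal (f y) * indicator A y \<le> ennreal (min (f y) (real n) * indicator (B n) y)"
    proof (cases "y \<in> A \<and> 0 < f y")
      case True
      have "\<forall>\<^sub>F n in sequentially. 1 / real (Suc n) < f y"
        using True lim_inverse_n'[THEN LIMSEQ_Suc] by (intro order_tendstoD) auto
      moreover have "\<forall>\<^sub>F n in sequentially. f y \<le> real n"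
        using filterlim_real_sequentially by (simp add: filterlim_at_top)
      ultimately show ?thesis
        by eventually_elim (use True in \<open>auto simp: B_def min_def\<close>)
    next
      case False
      then show ?thesis using f(2)[of y] by (auto simp: indicator_def not_less intro!: always_eventually)
    qed
  qed
  ultimately show ?thesis
    using nn_integral_liminf[of "\<lambda>n y. ennreal (min (f y) (real n) * indicator (B n) y)" "G x"]
    by (auto intro: order_trans)
qed

section \<open>Layer cake formula and comparison of distributions\<close>

text \<open>Tonelli on the region under the graph of \<open>f\<close>. Negative values of
  \<open>f\<close> are harmless: \<open>ennreal\<close> sends them to 0, and only levels
  \<open>t \<ge> 0\<close> are counted.\<close>

lemma nn_integral_layer_cake:
  assumes "sigma_finite_measure M" and [measurable]: "f \<in> borel_measurable M"
  shows "(\<integral>\<^sup>+ x. ennreal (f x) \<partial>M)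
    = (\<integral>\<^sup>+ t. indicator {0..} t * emeasure M {x \<in> space M. t < f x} \<partial>lborel)"
proof -
  interpret M: sigma_finite_measure M by fact
  interpret P: pair_sigma_finite M lborel ..
  have "ennreal (f x) = (\<integral>\<^sup>+ t. indicator {0..} t * indicator {..<f x} t \<partial>lborel)" for x
  proof -
    have "(\<integral>\<^sup>+ t. indicator {0..} t * indicator {..<f x} t \<partial>lborel) = (\<integral>\<^sup>+ t. indicator {0..<f x} t \<partial>lborel)"
      by (intro nn_integral_cong) (auto simp: indicator_def)
    then show ?thesis
      by (cases "0 \<le> f x") (auto simp: ennreal_neg)
  qed
  then have "(\<integral>\<^sup>+ x. ennreal (f x) \<partial>M)
      = (\<integral>\<^sup>+ x. \<integral>\<^sup>+ t. indicator {0..} t * indicator {..<f x} t \<partial>lborel \<partial>M)"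
    by simp
  also have "\<dots> = (\<integral>\<^sup>+ t. \<integral>\<^sup>+ x. indicator {0..} t * indicator {..<f x} t \<partial>M \<partial>lborel)"
    unfolding lessThan_iff indicator_def by (intro P.Fubini'[symmetric]) simp
  also have "\<dots> = (\<integral>\<^sup>+ t. indicator {0..} t * emeasure M {x \<in> space M. t < f x} \<partial>lborel)"
  proof (rule nn_integral_cong)
    fix t :: real
    have "(\<integral>\<^sup>+ x. indicator {0..} t * indicator {..<f x} t \<partial>M)
        = (\<integral>\<^sup>+ x. indicator {0..} t * indicator {x \<in> space M. t < f x} x \<partial>M)"
      by (intro nn_integral_cong) (auto simp: indicator_def)
    then show "(\<integral>\<^sup>+ x. indicator {0..} t * indicator {..<f x} t \<partial>M)
        = indicator {0..} t * emeasure M {x \<in> space M. t < f x}"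
      by (simp add: nn_integral_cmult_indicator)
  qed
  finally show ?thesis .
qed

text \<open>The hypotheses say that the law of \<open>w\<close> under \<open>M\<close> gives to each interval \<open>[0, s]\<close> at most the
  mass given to it by \<open>C\<close> times Lebesgue measure on \<open>[0, T]\<close>; superlevel sets of the decreasing
  function \<open>\<phi>\<close> are intervals of this kind.\<close>

lemma nn_integral_antimono_le:
  fixes \<phi> :: "real \<Rightarrow> real"
  assumes M: "finite_measure M" and w [measurable]: "w \<in> borel_measurable M"
    and w0: "\<And>x. x \<in> space M \<Longrightarrow> 0 \<le> w x"
    and \<phi> [measurable]: "\<phi> \<in> borel_measurable borel" and anti: "antimono_on {0..} \<phi>"
    and C: "0 \<le> C" and T: "0 \<le> T" and total: "emeasure M (space M) \<le> ennreal (C * T)"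
    and level: "\<And>s. 0 < s \<Longrightarrow> emeasure M {x \<in> space M. w x \<le> s} \<le> ennreal (C * s)"
  shows "(\<integral>\<^sup>+ x. ennreal (\<phi> (w x)) \<partial>M) \<le> ennreal C * (\<integral>\<^sup>+ s. ennreal (\<phi> s) * indicator {0..T} s \<partial>lborel)"
proof -
  define N where "N = density lborel (\<lambda>s. ennreal C * indicator {0..T} s)"
  have sets_N [measurable_cong]: "sets N = sets borel" and space_N: "space N = UNIV"
    by (auto simp: N_def)
  have N: "emeasure N S = ennreal C * emeasure lborel ({0..T} \<inter> S)" if "S \<in> sets borel" for S
    using that unfolding N_def
    by (simp add: emeasure_density mult.assoc nn_integral_cmult indicator_inter_arith[symmetric])
  have fin_N: "finite_measure N"
    using T by (intro finite_measureI) (auto simp: space_N N ennreal_mult_eq_top_iff)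
  have anti': "\<phi> t \<le> \<phi> s" if "0 \<le> s" "s \<le> t" for s t
    using anti that by (auto simp: monotone_on_def)
  \<comment> \<open>The endpoint \<open>Sup S\<close> below may be 0, so the level bound is extended
    to \<open>s = 0\<close> by approximation from the right. The denominator \<open>C + 1\<close>
    stays positive when \<open>C = 0\<close>.\<close>
  have level0: "emeasure M {x \<in> space M. w x \<le> s} \<le> ennreal (C * s)" if "0 \<le> s" for s
  proof (rule ennreal_le_epsilon)
    fix e :: real assume e: "0 < e"
    have "emeasure M {x \<in> space M. w x \<le> s} \<le> emeasure M {x \<in> space M. w x \<le> s + e / (C + 1)}"
      using e C by (intro emeasure_mono) (auto intro: add_increasing2)
    also have "\<dots> \<le> ennreal (C * (s + e / (C + 1)))"
      using e C that by (intro level) (simp add: add_nonneg_pos)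
    also have "\<dots> \<le> ennreal (C * s + e)"
      using e C by (intro ennreal_leI) (simp add: field_simps)
    also have "\<dots> = ennreal (C * s) + ennreal e"
      using e C that by (intro ennreal_plus) auto
    finally show "emeasure M {x \<in> space M. w x \<le> s} \<le> ennreal (C * s) + ennreal e" .
  qed
  have super: "emeasure M {x \<in> space M. t < \<phi> (w x)} \<le> emeasure N {s \<in> space N. t < \<phi> s}" for t
  proof -
    define S where "S = {s \<in> {0..T}. t < \<phi> s}"
    have NS: "emeasure N {s \<in> space N. t < \<phi> s} = ennreal C * emeasure lborel S"
      by (subst N) (auto simp: space_N S_def Int_def conj_commute)
    have S_borel [measurable]: "S \<in> sets borel"
      unfolding S_def by measurable
    \<comment> \<open>As \<open>\<phi>\<close> decreases, \<open>S\<close> is an initial segment of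
      \<open>{0..T}\<close>. If it is everything, the bound on the total mass applies; if it is
      empty, so is the superlevel set under \<open>M\<close>. Otherwise it is unknown whether
      \<open>Sup S\<close> lies in \<open>S\<close>: \<open>M\<close> is estimated on the closed
      segment, Lebesgue measure on the half-open one, and the two lengths agree.\<close>
    consider "t < \<phi> T" | "\<phi> T \<le> t" "S = {}" | "\<phi> T \<le> t" "S \<noteq> {}" by linarith
    then show ?thesis
    proof cases
      case 1
      then have "S = {0..T}"
        using anti' unfolding S_def by force
      moreover have "emeasure M {x \<in> space M. t < \<phi> (w x)} \<le> emeasure M (space M)"
        by (intro emeasure_mono) auto
      ultimately show ?thesis
        using total T C by (simp add: NS ennreal_mult)
    next
      case 2
      have "{x \<in> space M. t < \<phi> (w x)} = {}"
      proof -
        have "w x \<in> S" if "x \<in> space M" "t < \<phi> (w x)" for x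
          using that 2(1) anti'[OF T, of "w x"] w0[OF that(1)] by (force simp: S_def)
        with 2(2) show ?thesis by blast
      qed
      then show ?thesis by (simp only: emeasure_empty zero_le)
    next
      case 3
      have bdd: "bdd_above S" unfolding S_def by (auto intro: bdd_aboveI)
      obtain s0 where s0: "s0 \<in> S" using 3 by blast
      have "0 \<le> Sup S"
        using cSup_upper[OF s0 bdd] s0 by (simp add: S_def)
      have "w x \<le> Sup S" if "x \<in> space M" "t < \<phi> (w x)" for x
        using that 3(1) anti'[OF T, of "w x"] w0[OF that(1)]
        by (intro cSup_upper[OF _ bdd]) (force simp: S_def)
      then have "emeasure M {x \<in> space M. t < \<phi> (w x)} \<le> emeasure M {x \<in> space M. w x \<le> Sup S}"
        by (intro emeasure_mono) auto
      also have "\<dots> \<le> ennreal C * ennreal (Sup S)"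
        using level0[OF \<open>0 \<le> Sup S\<close>] C by (simp add: ennreal_mult')
      also have "ennreal (Sup S) \<le> emeasure lborel S"
      proof -
        have "{0..<Sup S} \<subseteq> S"
        proof
          fix r assume r: "r \<in> {0..<Sup S}"
          then obtain s where "s \<in> S" "r < s"
            using less_cSup_iff[OF 3(2) bdd] by auto
          then show "r \<in> S"
            using r anti'[of r s] by (auto simp: S_def)
        qed
        then have "emeasure lborel {0..<Sup S} \<le> emeasure lborel S"
          by (intro emeasure_mono) auto
        then show ?thesis using \<open>0 \<le> Sup S\<close> by simp
      qed
      finally show ?thesis
        using NS by (simp add: mult_left_mono)
    qed
  qed
  have "(\<integral>\<^sup>+ x. ennreal (\<phi> (w x)) \<partial>M) \<le> (\<integral>\<^sup>+ s. ennreal (\<phi> s) \<partial>N)"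
    using M fin_N super unfolding finite_measure_def
    by (subst (1 2) nn_integral_layer_cake) (auto intro!: nn_integral_mono mult_left_mono)
  also have "\<dots> = ennreal C * (\<integral>\<^sup>+ s. ennreal (\<phi> s) * indicator {0..T} s \<partial>lborel)"
    unfolding N_def
    by (subst nn_integral_density) (auto simp: nn_integral_cmult[symmetric] mult_ac)
  finally show ?thesis .
qed

section \<open>Integral bound for the kernel\<close>

text \<open>The comparison is applied to the measure with density \<open>f\<close> against
  \<open>G x\<close>, with \<open>C = b * h x\<close> and \<open>T = w x / b\<close>. Its total mass
  \<open>w x * h x\<close> is exactly \<open>C * T\<close>, and weak domination on
  \<open>{y. w y \<le> s}\<close> gives the level bounds. The derivative is required only up to
  \<open>w x / b\<close>, since for \<open>q < 0\<close> the antiderivative used is valid only below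
  1.\<close>

lemma kernel_op_antiderivative_le:
  fixes G :: "'a::{t2_space, second_countable_topology} \<Rightarrow> 'a measure" and f g h :: "'a \<Rightarrow> real"
  defines "w \<equiv> \<lambda>y. enn2real (kernel_op G (\<lambda>z. ennreal (f z)) y) / h y"
  assumes G: "radon_kernel G" and wdp: "weak_domination_principle G h b" and b: "0 < b"
    and h: "\<And>y. 0 < h y" and lsc: "lower_semicontinuous h"
    and f: "f \<in> borel_measurable borel" "\<And>y. 0 \<le> f y"
    and fin: "\<And>y. kernel_op G (\<lambda>z. ennreal (f z)) y < \<infinity>"
    and \<phi>: "\<phi> \<in> borel_measurable borel" "antimono_on {0..} \<phi>"
    and \<Phi>: "\<And>s. \<lbrakk>0 \<le> s; s \<le> w x / b\<rbrakk> \<Longrightarrow> (\<Phi> has_real_derivative \<phi> s) (at s) \<and> 0 \<le> \<phi> s"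
    and g: "\<And>y. g y \<le> f y * \<phi> (w y)"
  shows "kernel_op G (\<lambda>y. ennreal (g y)) x \<le> ennreal (b * h x * (\<Phi> (w x / b) - \<Phi> 0))"
proof -
  have sets_G [measurable_cong]: "sets (G y) = sets borel" for y
    using G by (simp add: radon_kernel_def radon_measure_def)
  have space_G: "space (G y) = UNIV" for y
    using sets_eq_imp_space_eq[OF sets_G] by simp
  note [measurable] = f(1) \<phi>(1) borel_measurable_lower_semicontinuous[OF lsc]
  have [measurable]: "kernel_op G (\<lambda>z. ennreal (f z)) \<in> borel_measurable borel"
    using G unfolding radon_kernel_def by simp
  have w [measurable]: "w \<in> borel_measurable borel"
    unfolding w_def by measurable
  have w0: "0 \<le> w y" for y
    using h[of y] by (simp add: w_def)
  have Gf: "kernel_op G (\<lambda>z. ennreal (f z)) y = ennreal (w y * h y)" for y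
    using fin[of y] h[of y] by (simp add: w_def)
  define M where "M = density (G x) (\<lambda>y. ennreal (f y))"
  have M: "emeasure M S = kernel_op G (\<lambda>y. ennreal (f y) * indicator S y) x" if "S \<in> sets borel" for S
    using that unfolding M_def kernel_op_def by (subst emeasure_density) (auto simp: sets_G)
  have space_M: "space M = UNIV" and sets_M [measurable_cong]: "sets M = sets borel"
    by (auto simp: M_def space_G sets_G)
  have total: "emeasure M (space M) = ennreal (w x * h x)"
    using Gf[of x] by (simp add: space_M M)
  have "(\<integral>\<^sup>+ y. ennreal (\<phi> (w y)) \<partial>M)
      \<le> ennreal (b * h x) * (\<integral>\<^sup>+ s. ennreal (\<phi> s) * indicator {0..w x / b} s \<partial>lborel)"
  proof (rule nn_integral_antimono_le)
    show "finite_measure M"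
      by (rule finite_measureI) (simp add: total)
    show "emeasure M {y \<in> space M. w y \<le> s} \<le> ennreal (b * h x * s)" if "0 < s" for s
      using weak_domination_measurable[OF G wdp f h that, of "{y. w y \<le> s}" x] fin h
      by (simp add: space_M M Gf ennreal_leI mult_right_mono less_imp_le mult_ac)
  qed (use b h[of x] w0 \<phi> total in \<open>auto simp: less_imp_le mult.commute\<close>)
  also have "(\<integral>\<^sup>+ s. ennreal (\<phi> s) * indicator {0..w x / b} s \<partial>lborel) = ennreal (\<Phi> (w x / b) - \<Phi> 0)"
  proof (rule nn_integral_has_integral_lebesgue')
    show "(\<phi> has_integral \<Phi> (w x / b) - \<Phi> 0) {0..w x / b}"
      using \<Phi> w0 b
      by (intro fundamental_theorem_of_calculus)
         (auto simp: has_real_derivative_iff_has_vector_derivative[symmetric] intro: has_field_derivative_at_within)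
  qed (use \<Phi> in auto)
  also have "ennreal (b * h x) * ennreal (\<Phi> (w x / b) - \<Phi> 0) = ennreal (b * h x * (\<Phi> (w x / b) - \<Phi> 0))"
    using b h[of x] by (simp add: ennreal_mult')
  finally have *: "(\<integral>\<^sup>+ y. ennreal (\<phi> (w y)) \<partial>M) \<le> ennreal (b * h x * (\<Phi> (w x / b) - \<Phi> 0))" .
  have "kernel_op G (\<lambda>y. ennreal (g y)) x \<le> (\<integral>\<^sup>+ y. ennreal (f y) * ennreal (\<phi> (w y)) \<partial>G x)"
    unfolding kernel_op_def using g f(2)
    by (intro nn_integral_mono) (auto simp: ennreal_mult'[symmetric] intro: ennreal_leI)
  also have "\<dots> = (\<integral>\<^sup>+ y. ennreal (\<phi> (w y)) \<partial>M)"
    unfolding M_def by (subst nn_integral_density) auto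
  finally show ?thesis
    using * by (rule order_trans)
qed

section \<open>Calculus with powers\<close>

text \<open>Covers both signs of \<open>q\<close> at once: \<open>c = 1\<close> serves
  \<open>q > 0\<close> and \<open>c = -1\<close> serves \<open>q < 0\<close>.\<close>

lemma powr_antiderivative:
  fixes q s :: real
  assumes "q \<noteq> 1" "0 < 1 + c * s" "c \<noteq> 0"
  shows "((\<lambda>s. (1 + c * s) powr (1 - q) / (c * (1 - q))) has_real_derivative (1 + c * s) powr (- q)) (at s)"
proof -
  have "((\<lambda>s. (1 + c * s) powr (1 - q)) has_real_derivative
      (1 - q) * (1 + c * s) powr (1 - q - 1) * c) (at s)"
    using assms by (auto intro!: derivative_eq_intros)
  from DERIV_cdivide[OF this, of "c * (1 - q)"] show ?thesis
    using assms by simp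
qed

text \<open>Inverts the increasing map sending \<open>z\<close> to
  \<open>(z powr p - 1) / p\<close>. For \<open>p < 0\<close>, multiplying by \<open>p\<close> and
  raising to the power \<open>1 / p\<close> each reverse the inequality, so the direction is the
  same. It is applied with \<open>p = 1 - q\<close>.\<close>

lemma powr_inverse_le:
  fixes p A B z :: real
  assumes "p \<noteq> 0" "0 < z" "0 \<le> A" "A \<le> (z powr p - 1) / p"
  shows "(1 + p * A) powr (1 / p) \<le> z"
proof (cases "0 < p")
  case True
  then have "0 \<le> 1 + p * A" "1 + p * A \<le> z powr p"
    using assms by (auto simp: field_simps)
  then have "(1 + p * A) powr (1 / p) \<le> (z powr p) powr (1 / p)"
    using True by (intro powr_mono2) auto
  then show ?thesis using assms by (simp add: powr_powr)
next
  case False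
  then have "z powr p \<le> 1 + p * A"
    using assms by (auto simp: field_simps)
  then have "(1 + p * A) powr (1 / p) \<le> (z powr p) powr (1 / p)"
    using False assms by (intro powr_mono2') auto
  then show ?thesis using assms by (simp add: powr_powr)
qed

section \<open>The estimates of \<open>u\<close> for each range of \<open>q\<close>\<close>

theorem theorem5p1:
  fixes G :: "'a::{t2_space, second_countable_topology} \<Rightarrow> 'a measure"
    and h u :: "'a \<Rightarrow> real"
    and b q :: real
  assumes "locally_compact_space (euclidean :: 'a topology)"
    and "radon_kernel G"
    and "\<And>x. 0 < h x"
    and "lower_semicontinuous h"
    and "1 \<le> b"
    and "weak_domination_principle G h b"
    and "q \<noteq> 0"
    and "u \<in> borel_measurable borel"
    and "0 < q \<Longrightarrow> \<forall>x. 0 \<le> u x \<and> ennreal (u x) \<ge> kernel_pow G q u x + ennreal (h x)"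
    and "q < 0 \<Longrightarrow> \<forall>x. 0 < u x \<and> ereal (u x) \<le> - enn2ereal (kernel_pow G q u x) + ereal (h x)"
  shows "(0 < q \<and> q \<noteq> 1 \<longrightarrow>
            (\<forall>x. kernel_pow G q h x < \<infinity> \<and>
                 (1 < q \<longrightarrow> kernel_pow G q h x < ennreal (b / (q - 1) * h x)) \<and>
                 u x \<ge> h x * (1 + b * ((1 + (1 - q) * enn2real (kernel_pow G q h x) / (b * h x))
                                         powr (1 / (1 - q)) - 1))))
       \<and> (q = 1 \<longrightarrow>
            (\<forall>x. kernel_op G (\<lambda>y. ennreal (h y)) x < \<infinity> \<and>
                 u x \<ge> h x * (1 + b * (exp (1 / b * (enn2real (kernel_op G (\<lambda>y. ennreal (h y)) x) / h x))
                                         - 1))))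
       \<and> (q < 0 \<longrightarrow>
            (\<forall>x. kernel_pow G q h x
                   < ennreal (b / (1 - q) * (1 - (1 - 1 / b) powr (1 - q)) * h x) \<and>
                 u x \<le> h x * (1 - b * (1 - (1 - (1 - q) * enn2real (kernel_pow G q h x) / (b * h x))
                                             powr (1 / (1 - q))))))"

proof -
  note G = assms(2) and h = assms(3) and lsc = assms(4) and b = assms(5) and wdp = assms(6)
  have b0: "0 < b" using b by simp
  define f where "f y = u y powr q" for y
  have f: "f \<in> borel_measurable borel" "\<And>y. 0 \<le> f y"
    unfolding f_def using assms(8) by measurable
  have kernel_u: "kernel_pow G q u = kernel_op G (\<lambda>y. ennreal (f y))"
    by (simp add: kernel_pow_def f_def)
  define w where "w y = enn2real (kernel_op G (\<lambda>z. ennreal (f z)) y) / h y" for y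
  have w0: "0 \<le> w y" for y
    using h[of y] by (simp add: w_def)
  \<comment> \<open>\<open>enn2real\<close> sends infinity to 0, so \<open>w\<close> represents the
    potential only once finiteness is known.\<close>
  have wh: "kernel_pow G q u y = ennreal (w y * h y)" if "kernel_pow G q u y < \<infinity>" for y
    using that h[of y] by (simp add: w_def kernel_u)
  note bound = kernel_op_antiderivative_le[OF G wdp b0 h lsc f, folded w_def kernel_u]

  \<comment> \<open>The antiderivative stays arbitrary so that the power
    (\<open>q \<noteq> 1\<close>) and the logarithm (\<open>q = 1\<close>) share one
    argument.\<close>
  have pos: "kernel_pow G q h x \<le> ennreal (b * h x * (\<Phi> (w x / b) - \<Phi> 0)) \<and> h x * (1 + w x) \<le> u x"
    if q: "0 < q" and \<Phi>: "\<And>s. 0 \<le> s \<Longrightarrow> (\<Phi> has_real_derivative (1 + s) powr (- q)) (at s)" for \<Phi> x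
  proof -
    have fin: "kernel_pow G q u y < \<infinity>" for y
    proof -
      have "kernel_pow G q u y \<le> kernel_pow G q u y + ennreal (h y)" by simp
      also have "\<dots> \<le> ennreal (u y)" using assms(9)[OF q] by blast
      finally show ?thesis by (auto intro: le_less_trans)
    qed
    have uh: "h y * (1 + w y) \<le> u y" for y
    proof -
      have "ennreal (h y * (1 + w y)) = kernel_pow G q u y + ennreal (h y)"
        using wh[OF fin, of y] w0[of y] h[of y]
        by (simp add: ennreal_plus[symmetric] algebra_simps del: ennreal_plus)
      also have "\<dots> \<le> ennreal (u y)" using assms(9)[OF q] by blast
      finally show ?thesis using assms(9)[OF q] by (simp add: ennreal_le_iff)
    qed
    have "h y powr q \<le> f y * (1 + w y) powr (- q)" for y
    proof -
      have "h y \<le> u y / (1 + w y)"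
        using uh[of y] w0[of y] by (simp add: field_simps)
      then have "h y powr q \<le> (u y / (1 + w y)) powr q"
        using h[of y] q by (intro powr_mono2) auto
      also have "\<dots> = f y * (1 + w y) powr (- q)"
        using w0[of y] uh[of y] h[of y] assms(9)[OF q]
        by (simp add: f_def powr_divide powr_minus_divide)
      finally show ?thesis .
    qed
    moreover have "antimono_on {0..} (\<lambda>s. (1 + s) powr (- q))"
      using q by (auto intro!: monotone_onI powr_mono2')
    ultimately show ?thesis
      using bound[of "\<lambda>s. (1 + s) powr (- q)" x \<Phi> "\<lambda>y. h y powr q"] fin \<Phi> uh
      unfolding kernel_pow_def[of G q h] by auto
  qed

  have neg: "kernel_pow G q h x \<le> ennreal (b * h x * ((1 - (1 - w x / b) powr (1 - q)) / (1 - q)))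
      \<and> u x \<le> h x * (1 - w x) \<and> w x < 1"
    if q: "q < 0" for x
  proof -
    have uk: "0 < u y" "ereal (u y) \<le> - enn2ereal (kernel_pow G q u y) + ereal (h y)" for y
      using assms(10)[OF q] by auto
    have fin: "kernel_pow G q u y < \<infinity>" for y
      using uk(2)[of y] by (cases "kernel_pow G q u y") auto
    have uh: "u y \<le> h y * (1 - w y)" for y
      using uk(2)[of y] wh[OF fin, of y] w0[of y] h[of y]
      by (simp add: enn2ereal_ennreal algebra_simps)
    \<comment> \<open>Positivity of \<open>u\<close> enters here; the strictness later yields the
      strict necessary condition.\<close>
    have w1: "w y < 1" for y
      using less_le_trans[OF uk(1) uh, of y] h[of y] by (simp add: zero_less_mult_iff)
    have wb: "w x / b < 1"
      using w1[of x] b by simp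
    \<comment> \<open>The weight must decrease on all of \<open>{0..}\<close>, so
      \<open>1 - s\<close> is cut off at 0, where \<open>0 powr (- q) = 0\<close>. Up to
      \<open>w x / b < 1\<close> the cutoff is inactive.\<close>
    have "h y powr q \<le> f y * max 0 (1 - w y) powr (- q)" for y
    proof -
      have "u y / (1 - w y) \<le> h y"
        using uh[of y] w1[of y] by (simp add: field_simps)
      then have "h y powr q \<le> (u y / (1 - w y)) powr q"
        using uk(1)[of y] w1[of y] q by (intro powr_mono2') auto
      also have "\<dots> = f y * max 0 (1 - w y) powr (- q)"
        using w1[of y] uk(1)[of y] by (simp add: f_def powr_divide powr_minus_divide)
      finally show ?thesis .
    qed
    moreover have "antimono_on {0..} (\<lambda>s. max 0 (1 - s) powr (- q))"
      using q by (auto intro!: monotone_onI powr_mono2)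
    moreover have "((\<lambda>s. (1 - s) powr (1 - q) / - (1 - q)) has_real_derivative max 0 (1 - s) powr (- q)) (at s)"
      if "s \<le> w x / b" for s
      using powr_antiderivative[of q "-1" s] that wb q by simp
    ultimately have "kernel_pow G q h x \<le> ennreal (b * h x *
        ((1 - w x / b) powr (1 - q) / - (1 - q) - (1 - 0) powr (1 - q) / - (1 - q)))"
      unfolding kernel_pow_def[of G q h]
      by (intro bound[of "\<lambda>s. max 0 (1 - s) powr (- q)" x "\<lambda>s. (1 - s) powr (1 - q) / - (1 - q)"]) (use fin in auto)
    also have "(1 - w x / b) powr (1 - q) / - (1 - q) - (1 - 0) powr (1 - q) / - (1 - q)
        = (1 - (1 - w x / b) powr (1 - q)) / (1 - q)"
      by (simp add: diff_divide_distrib del: minus_diff_eq)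
    finally show ?thesis using uh w1 by blast
  qed

  show ?thesis
  proof (intro conjI impI allI; (elim conjE)?)
    fix x assume q: "0 < q" "q \<noteq> 1"
    define z where "z = 1 + w x / b"
    have z: "1 \<le> z" using w0[of x] b0 by (simp add: z_def)
    \<comment> \<open>\<open>C\<close> is the integral of \<open>(1 + s) powr (- q)\<close> over
      \<open>{0..w x / b}\<close>.\<close>
    define C where "C = (z powr (1 - q) - 1) / (1 - q)"
    have "0 \<le> C"
    proof (cases "q < 1")
      case True
      then show ?thesis using z by (simp add: C_def ge_one_powr_ge_zero)
    next
      case False
      then have "z powr (1 - q) \<le> z powr 0" using z q by (intro powr_mono) auto
      then show ?thesis using False q z by (simp add: C_def divide_nonpos_neg)
    qed
    have A: "kernel_pow G q h x \<le> ennreal (b * h x * C)" and u: "h x * (1 + w x) \<le> u x"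
      using pos[OF q(1), of "\<lambda>s. (1 + s) powr (1 - q) / (1 - q)" x] powr_antiderivative[of q 1] q
      by (auto simp: C_def z_def diff_divide_distrib)
    show "kernel_pow G q h x < \<infinity>"
      using A by (auto intro: le_less_trans)
    show "kernel_pow G q h x < ennreal (b / (q - 1) * h x)" if "1 < q"
    proof -
      \<comment> \<open>For \<open>q > 1\<close> the integral over the whole half-line converges to
        \<open>1 / (q - 1)\<close>, and \<open>C\<close> stays strictly below it.\<close>
      have "0 < z powr (1 - q)" using z by simp
      then have "C < 1 / (q - 1)" using that by (simp add: C_def field_simps)
      then have "b * h x * C < b * h x * (1 / (q - 1))"
        using b0 h[of x] by (intro mult_strict_left_mono) auto
      then have "b * h x * C < b / (q - 1) * h x" by simp
      then show ?thesis
        using A that b0 h[of x] by (auto intro!: le_less_trans[OF A] ennreal_lessI)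
    qed
    define A' where "A' = enn2real (kernel_pow G q h x) / (b * h x)"
    have "enn2real (kernel_pow G q h x) \<le> b * h x * C"
      using A \<open>0 \<le> C\<close> b0 h[of x] by (intro enn2real_leI) auto
    then have "A' \<le> C" "0 \<le> A'"
      using b0 h[of x] by (auto simp: A'_def field_simps)
    then have "(1 + (1 - q) * A') powr (1 / (1 - q)) \<le> z"
      using q z unfolding C_def by (intro powr_inverse_le) auto
    then have "b * ((1 + (1 - q) * A') powr (1 / (1 - q)) - 1) \<le> w x"
      using b0 by (simp add: z_def field_simps)
    then have "h x * (1 + b * ((1 + (1 - q) * A') powr (1 / (1 - q)) - 1)) \<le> h x * (1 + w x)"
      using h[of x] by (intro mult_left_mono) auto
    then show "h x * (1 + b * ((1 + (1 - q) * enn2real (kernel_pow G q h x) / (b * h x))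
        powr (1 / (1 - q)) - 1)) \<le> u x"
      using u by (simp add: A'_def)
  next
    fix x assume q: "q = 1"
    have kernel_h: "kernel_op G (\<lambda>y. ennreal (h y)) x = kernel_pow G q h x"
      using h by (simp add: kernel_pow_def q less_imp_le)
    have "((\<lambda>s. ln (1 + s)) has_real_derivative (1 + s) powr (- q)) (at s)" if "0 \<le> s" for s
      using that q by (auto intro!: derivative_eq_intros simp: powr_minus_divide)
    from pos[OF _ this] have A: "kernel_pow G q h x \<le> ennreal (b * h x * ln (1 + w x / b))"
      and u: "h x * (1 + w x) \<le> u x"
      using q by auto
    show "kernel_op G (\<lambda>y. ennreal (h y)) x < \<infinity>"
      using A by (auto simp: kernel_h intro: le_less_trans)
    define A' where "A' = 1 / b * (enn2real (kernel_pow G q h x) / h x)"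
    have "enn2real (kernel_pow G q h x) \<le> b * h x * ln (1 + w x / b)"
      using A w0[of x] b0 h[of x] by (intro enn2real_leI) auto
    then have "A' \<le> ln (1 + w x / b)"
      using b0 h[of x] by (auto simp: A'_def field_simps)
    then have "exp A' \<le> 1 + w x / b"
      using w0[of x] b0 by (subst ln_ge_iff[symmetric]) (auto intro: add_pos_nonneg)
    then have "b * (exp A' - 1) \<le> w x"
      using b0 by (simp add: field_simps)
    then have "h x * (1 + b * (exp A' - 1)) \<le> h x * (1 + w x)"
      using h[of x] by (intro mult_left_mono) auto
    then show "h x * (1 + b * (exp (1 / b * (enn2real (kernel_op G (\<lambda>y. ennreal (h y)) x) / h x)) - 1)) \<le> u x"
      using u by (simp add: A'_def kernel_h)
  next
    fix x assume q: "q < 0"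
    define z where "z = 1 - w x / b"
    have w1: "w x < 1" and u: "u x \<le> h x * (1 - w x)"
      and A: "kernel_pow G q h x \<le> ennreal (b * h x * ((1 - z powr (1 - q)) / (1 - q)))"
      using neg[OF q, of x] by (auto simp: z_def)
    \<comment> \<open>The strict lower bound is \<open>w x < 1\<close> rewritten for
      \<open>z\<close>. Since \<open>b \<ge> 1\<close>, it lies in the range where the power
      \<open>1 - q > 0\<close> is strictly increasing, which gives the necessary condition.\<close>
    have z: "1 - 1 / b < z" "z \<le> 1" "0 \<le> 1 - 1 / b"
      using w1 w0[of x] b by (auto simp: z_def field_simps)
    have zp: "z powr (1 - q) \<le> 1"
      using z q by (intro powr_le1) auto
    have "(1 - 1 / b) powr (1 - q) < z powr (1 - q)"
      using z q by (intro powr_less_mono2) auto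
    then have "b * h x / (1 - q) * (1 - z powr (1 - q)) < b * h x / (1 - q) * (1 - (1 - 1 / b) powr (1 - q))"
      using q b0 h[of x] by (intro mult_strict_left_mono) auto
    moreover have "0 \<le> b * h x / (1 - q) * (1 - z powr (1 - q))"
      using q b0 h[of x] zp by simp
    ultimately show "kernel_pow G q h x < ennreal (b / (1 - q) * (1 - (1 - 1 / b) powr (1 - q)) * h x)"
      by (intro le_less_trans[OF A] ennreal_lessI) (auto simp: mult_ac)
    define A' where "A' = enn2real (kernel_pow G q h x) / (b * h x)"
    have "enn2real (kernel_pow G q h x) \<le> b * h x * ((1 - z powr (1 - q)) / (1 - q))"
      using A zp q b0 h[of x] by (intro enn2real_leI) auto
    then have "z powr (1 - q) \<le> 1 - (1 - q) * A'"
      using b0 h[of x] q by (simp add: A'_def field_simps)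
    then have "(z powr (1 - q)) powr (1 / (1 - q)) \<le> (1 - (1 - q) * A') powr (1 / (1 - q))"
      using q by (intro powr_mono2) auto
    then have "z \<le> (1 - (1 - q) * A') powr (1 / (1 - q))"
      using z q by (simp add: powr_powr)
    then have "1 - w x \<le> 1 - b * (1 - (1 - (1 - q) * A') powr (1 / (1 - q)))"
      using b0 by (simp add: z_def field_simps)
    then have "h x * (1 - w x) \<le> h x * (1 - b * (1 - (1 - (1 - q) * A') powr (1 / (1 - q))))"
      using h[of x] by (intro mult_left_mono) auto
    then show "u x \<le> h x * (1 - b * (1 - (1 - (1 - q) * enn2real (kernel_pow G q h x) / (b * h x))
        powr (1 / (1 - q))))"
      using u by (simp add: A'_def)
  qed
qed

end
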